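(* Let $\{x_k\}$ be the sequence produced by the RBCD method with exact data $y$. Assume that $\mathcal X$ is separable and $0<\gamma<2/\|A\|^2$. Then $\{x_k\}$ converges weakly, almost surely, to a random solution $\bar x$ of $Ax=y$.
   Context: Let $b\ge1$, let $X_1,\dots,X_b$ and $\mathcal Y$ be real Hilbert spaces, and let $A_i:X_i\to\mathcal Y$ be bounded linear operators with adjoints $A_i^*$. Let $\mathcal X:=X_1\times\cdots\times X_b$ with the natural product inner product and define $A:\mathcal X\to\mathcal Y$, $Ax:=\sum_{i=1}^bA_ix_i$ for $x=(x_1,\dots,x_b)$. It is assumed that $y\in\mathrm{Ran}(A)$. RBCD method with exact data $y$, initial guess $x_0\in\mathcal X$ and step size $\gamma>0$: let $i_0,i_1,i_2,\dots$ be independent random indices, each uniformly distributed on $\{1,\dots,b\}$. For $k\ge0$ set $x_{k+1,i}=x_{k,i}$ for $i\ne i_k$ and $x_{k+1,i_k}=x_{k,i_k}-\gamma A_{i_k}^*(Ax_k-y)$. Separable means having a countable dense subset. The conclusion means that there is an event of probability one and a random element $\bar x$ with values in $\mathcal X$ such that along every sample path in that event $A\bar x=y$ and $x_k\rightharpoonup\bar x$ weakly. *)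

theory Defs
  imports "HOL-Probability.Probability"
begin

text \<open>
  The Hilbert spaces \<open>X\<^sub>1, \<dots>, X\<^sub>b\<close> may differ from one another. They are rendered as a family
  \<open>X :: 'b \<Rightarrow> 'x set\<close>, indexed by a finite type with \<open>b = CARD('b)\<close> elements, of complete linear
  subspaces of an arbitrary real inner product space \<open>'x\<close>. This is no restriction, since
  any finite family of Hilbert spaces embeds isometrically, coordinate by coordinate, into
  its product. Maps on \<open>X i\<close> are total functions on \<open>'x\<close> whose values outside \<open>X i\<close> are
  irrelevant; hence the following versions of library notions relative to a set.
\<close>

definition bounded_linear_on ::
    "'a::real_normed_vector set \<Rightarrow> ('a \<Rightarrow> 'c::real_normed_vector) \<Rightarrow> bool" where
  "bounded_linear_on S f \<longleftrightarrow>
     (\<forall>u\<in>S. \<forall>v\<in>S. f (u + v) = f u + f v) \<and>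
     (\<forall>r. \<forall>u\<in>S. f (r *\<^sub>R u) = r *\<^sub>R f u) \<and>
     (\<exists>K. \<forall>u\<in>S. norm (f u) \<le> K * norm u)"

definition onorm_on ::
    "'a::real_normed_vector set \<Rightarrow> ('a \<Rightarrow> 'c::real_normed_vector) \<Rightarrow> real" where
  "onorm_on S f = (SUP u\<in>S. norm (f u) / norm u)"

text \<open>
  For \<open>S\<close> a complete subspace and \<open>f\<close> bounded linear on \<open>S\<close>, the element described below exists
  and is unique (Riesz), and \<open>adjoint_on S f\<close> is the Hilbert space adjoint of \<open>f\<close>, with
  values in \<open>S\<close>.
\<close>

definition adjoint_on ::
    "'a::real_inner set \<Rightarrow> ('a \<Rightarrow> 'c::real_inner) \<Rightarrow> 'c \<Rightarrow> 'a" where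
  "adjoint_on S f w = (THE z. z \<in> S \<and> (\<forall>u\<in>S. f u \<bullet> w = u \<bullet> z))"

definition weakly_converges_on ::
    "'a::real_normed_vector set \<Rightarrow> (nat \<Rightarrow> 'a) \<Rightarrow> 'a \<Rightarrow> bool" where
  "weakly_converges_on S x l \<longleftrightarrow>
     (\<forall>n. x n \<in> S) \<and> l \<in> S \<and>
     (\<forall>\<phi> :: 'a \<Rightarrow> real. bounded_linear_on S \<phi> \<longrightarrow> (\<lambda>n. \<phi> (x n)) \<longlonglongrightarrow> \<phi> l)"

text \<open>
  The inner product of \<open>'x ^ 'b\<close> is the sum of the coordinatewise inner products, so
  \<open>block_space X\<close> is the Hilbert space product of the \<open>X i\<close>.
\<close>

definition block_space :: "('b \<Rightarrow> 'x set) \<Rightarrow> ('x ^ 'b) set" where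
  "block_space X = {x. \<forall>i. x $ i \<in> X i}"

definition block_op ::
    "('b \<Rightarrow> 'x \<Rightarrow> 'y::real_inner) \<Rightarrow> 'x ^ 'b::finite \<Rightarrow> 'y" where
  "block_op A x = (\<Sum>i\<in>UNIV. A i (x $ i))"

definition rbcd_step ::
    "('b \<Rightarrow> 'x set) \<Rightarrow> ('b \<Rightarrow> 'x \<Rightarrow> 'y::real_inner) \<Rightarrow> 'y \<Rightarrow> real \<Rightarrow> 'b \<Rightarrow>
     'x::real_inner ^ 'b::finite \<Rightarrow> 'x ^ 'b" where
  "rbcd_step X A y \<gamma> i x =
     (\<chi> j. if j = i then x $ i - \<gamma> *\<^sub>R adjoint_on (X i) (A i) (block_op A x - y) else x $ j)"

primrec rbcd ::
    "('b \<Rightarrow> 'x set) \<Rightarrow> ('b \<Rightarrow> 'x \<Rightarrow> 'y::real_inner) \<Rightarrow> 'y \<Rightarrow> real \<Rightarrow> 'x::real_inner ^ 'b::finite \<Rightarrow>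
     (nat \<Rightarrow> 'b) \<Rightarrow> nat \<Rightarrow> 'x ^ 'b" where
  "rbcd X A y \<gamma> x0 i 0 = x0"
| "rbcd X A y \<gamma> x0 i (Suc k) = rbcd_step X A y \<gamma> (i k) (rbcd X A y \<gamma> x0 i k)"

end

theory Submission
  imports Defs
begin

text \<open>
  For every solution \<open>z\<close> the average of \<open>\<parallel>x\<^sub>k\<^sub>+\<^sub>1 - z\<parallel>\<^sup>2\<close> over the next index is at most
  \<open>\<parallel>x\<^sub>k - z\<parallel>\<^sup>2 - (\<gamma>/b) (2 - \<gamma> \<parallel>A\<parallel>\<^sup>2) \<parallel>A x\<^sub>k - y\<parallel>\<^sup>2\<close>. Hence \<open>\<parallel>x\<^sub>k - z\<parallel>\<^sup>2\<close> is a nonnegative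
  supermartingale, which converges almost surely, and \<open>A x\<^sub>k \<rightarrow> y\<close> almost surely.

  Supermartingale convergence follows from the maximal inequality alone: the wealth of a trader
  who buys the supermartingale below \<open>a\<close> and sells it above \<open>b > a\<close> is itself a nonnegative
  supermartingale, thus almost surely bounded, but it is multiplied by \<open>b/a\<close> at each upcrossing.

  Weak compactness is not needed. On an event of probability one, \<open>x\<^sub>k \<bullet> A\<^sup>* w \<rightarrow> y \<bullet> w\<close>, and
  \<open>x\<^sub>k \<bullet> n\<close> converges for the projections \<open>n\<close> onto the kernel of \<open>A\<close> of a countable dense set,
  by comparing the limits of \<open>\<parallel>x\<^sub>k - z\<parallel>\<^sup>2\<close> and \<open>\<parallel>x\<^sub>k - (z + n)\<parallel>\<^sup>2\<close>. These test vectors are total and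
  \<open>x\<^sub>k\<close> is bounded, so \<open>x\<^sub>k \<bullet> u\<close> converges for all \<open>u\<close>, and the Riesz theorem gives the weak limit.
\<close>

section \<open>The Riesz theorem on complete subspaces\<close>

lemma bounded_linear_onI:
  assumes "\<And>u v. u \<in> S \<Longrightarrow> v \<in> S \<Longrightarrow> f (u + v) = f u + f v"
    and "\<And>r u. u \<in> S \<Longrightarrow> f (r *\<^sub>R u) = r *\<^sub>R f u"
    and "\<And>u. u \<in> S \<Longrightarrow> norm (f u) \<le> K * norm u"
  shows "bounded_linear_on S f"
  using assms unfolding bounded_linear_on_def by blast

lemma bounded_linear_on_bound:
  assumes "bounded_linear_on S f"
  obtains K where "K \<ge> 0" "\<And>u. u \<in> S \<Longrightarrow> norm (f u) \<le> K * norm u"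
proof -
  obtain K where K: "\<forall>u\<in>S. norm (f u) \<le> K * norm u"
    using assms unfolding bounded_linear_on_def by blast
  have "norm (f u) \<le> max K 0 * norm u" if "u \<in> S" for u
    using K that by (meson dual_order.trans max.cobounded1 mult_right_mono norm_ge_zero)
  then show thesis using that[of "max K 0"] by simp
qed

text \<open>Boundedness makes the supremum in \<open>onorm_on\<close> a genuine one; at
  \<open>u = 0\<close> its quotient is 0 by the convention on division.\<close>

lemma norm_le_onorm_on:
  assumes "bounded_linear_on S f" "u \<in> S"
  shows "norm (f u) \<le> onorm_on S f * norm u"
proof -
  obtain K where K: "K \<ge> 0" "\<And>u. u \<in> S \<Longrightarrow> norm (f u) \<le> K * norm u"
    using bounded_linear_on_bound[OF assms(1)] by blast
  have "bdd_above ((\<lambda>u. norm (f u) / norm u) ` S)"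
  proof (rule bdd_aboveI2)
    fix u assume "u \<in> S"
    then show "norm (f u) / norm u \<le> K"
      using K by (cases "u = 0") (auto simp: divide_le_eq)
  qed
  then have "norm (f u) / norm u \<le> onorm_on S f"
    unfolding onorm_on_def using assms(2) by (rule cSUP_upper2) simp_all
  then show ?thesis
    using K(2)[OF assms(2)] by (cases "u = 0") (auto simp: divide_le_eq)
qed

text \<open>The ambient space is only an inner product space, so completeness of \<open>S\<close>
  must supply the minimiser. Adjoints, projections and the weak limit are all obtained from this
  lemma.\<close>

lemma riesz_on:
  fixes S :: "'a::real_inner set" and \<phi> :: "'a \<Rightarrow> real"
  assumes S: "subspace S" "Topological_Spaces.complete S" and \<phi>: "bounded_linear_on S \<phi>"
  obtains z where "z \<in> S" "\<And>u. u \<in> S \<Longrightarrow> \<phi> u = u \<bullet> z"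
proof -
  have add: "\<phi> (u + v) = \<phi> u + \<phi> v" if "u \<in> S" "v \<in> S" for u v
    using \<phi> that unfolding bounded_linear_on_def by blast
  have scale: "\<phi> (r *\<^sub>R u) = r * \<phi> u" if "u \<in> S" for r u
    using \<phi> that unfolding bounded_linear_on_def by simp
  obtain K where K: "K \<ge> 0" "\<And>u. u \<in> S \<Longrightarrow> norm (\<phi> u) \<le> K * norm u"
    using bounded_linear_on_bound[OF \<phi>] by blast
  txt \<open>The representing vector is the minimiser of \<open>J\<close>; minimising sequences are Cauchy by the
    parallelogram law.\<close>
  define J where "J u = u \<bullet> u - 2 * \<phi> u" for u
  define m where "m = (INF u\<in>S. J u)"
  have ne: "S \<noteq> {}" using S(1) subspace_0 by blast
  have low: "J u \<ge> - K\<^sup>2" if "u \<in> S" for u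
  proof -
    have "0 \<le> (norm u - K)\<^sup>2" by simp
    moreover have "\<phi> u \<le> K * norm u" using K(2)[OF that] by simp
    ultimately show ?thesis
      unfolding J_def dot_square_norm power2_diff by (simp add: algebra_simps)
  qed
  have bdd: "bdd_below (J ` S)" by (rule bdd_belowI2[OF low])
  have mle: "m \<le> J u" if "u \<in> S" for u
    unfolding m_def by (rule cINF_lower[OF bdd that])
  \<comment> \<open>\<open>(norm (u - v))\<^sup>2\<close> equals \<open>2 * J u + 2 * J v\<close>
    minus four times \<open>J\<close> at the midpoint: the linear terms cancel, and the midpoint
    lies in \<open>S\<close>.\<close>
  have par: "(norm (u - v))\<^sup>2 \<le> 2 * (J u - m) + 2 * (J v - m)" if "u \<in> S" "v \<in> S" for u v
  proof -
    have uv: "u + v \<in> S" using S(1) that by (rule subspace_add)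
    then have "m \<le> J ((1/2) *\<^sub>R (u + v))"
      by (intro mle subspace_scale[OF S(1)])
    also have "\<dots> = (u \<bullet> u + 2 * (u \<bullet> v) + v \<bullet> v) / 4 - (\<phi> u + \<phi> v)"
      unfolding J_def scale[OF uv] add[OF that]
      by (simp add: inner_add_left inner_add_right inner_commute field_simps)
    finally show ?thesis
      unfolding J_def dot_square_norm[symmetric]
      by (simp add: inner_diff_left inner_diff_right inner_commute field_simps)
  qed
  have "\<exists>u\<in>S. J u < m + inverse (real (Suc n))" for n
  proof -
    have "Inf (J ` S) < m + inverse (real (Suc n))" unfolding m_def by simp
    then show ?thesis using cInf_lessD[of "J ` S"] ne by blast
  qed
  then obtain s where s: "\<And>n. s n \<in> S" "\<And>n. J (s n) < m + inverse (real (Suc n))" by metis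
  have Jlim: "(\<lambda>n. J (s n)) \<longlonglongrightarrow> m"
  proof (rule tendsto_sandwich[OF _ _ tendsto_const])
    show "(\<lambda>n. m + inverse (real (Suc n))) \<longlonglongrightarrow> m"
      using tendsto_add[OF tendsto_const LIMSEQ_inverse_real_of_nat, of m] by simp
  qed (use s mle in \<open>auto intro!: always_eventually less_imp_le\<close>)
  have "Cauchy s"
  proof (rule metric_CauchyI)
    fix e :: real assume "e > 0"
    then have "eventually (\<lambda>n. J (s n) < m + e\<^sup>2 / 4) sequentially"
      using order_tendstoD(2)[OF Jlim, of "m + e\<^sup>2 / 4"] by simp
    then obtain N where N: "\<And>n. n \<ge> N \<Longrightarrow> J (s n) < m + e\<^sup>2 / 4"
      unfolding eventually_sequentially by blast
    have "dist (s i) (s j) < e" if "i \<ge> N" "j \<ge> N" for i j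
    proof -
      have "(norm (s i - s j))\<^sup>2 < e\<^sup>2"
        using par[OF s(1) s(1), of i j] N[OF that(1)] N[OF that(2)] by simp
      then show ?thesis
        using \<open>e > 0\<close> unfolding dist_norm by (simp add: power2_less_imp_less)
    qed
    then show "\<exists>N. \<forall>i\<ge>N. \<forall>j\<ge>N. dist (s i) (s j) < e" by blast
  qed
  then obtain z where z: "z \<in> S" "s \<longlonglongrightarrow> z"
    using S(2) s(1) unfolding complete_def by blast
  have "(\<lambda>n. \<phi> (s n)) \<longlonglongrightarrow> \<phi> z"
  proof (rule LIM_zero_cancel, rule Lim_null_comparison)
    show "(\<lambda>n. K * norm (s n - z)) \<longlonglongrightarrow> 0"
      using z(2) by (intro tendsto_mult_right_zero tendsto_norm_zero LIM_zero)
    have "\<phi> (s n) - \<phi> z = \<phi> (s n - z)" for n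
      using add[of "s n - z" z] subspace_diff[OF S(1) s(1) z(1)] z(1) by simp
    then show "\<forall>\<^sub>F n in sequentially. norm (\<phi> (s n) - \<phi> z) \<le> K * norm (s n - z)"
      using K(2) subspace_diff[OF S(1) s(1) z(1)] by simp
  qed
  then have "(\<lambda>n. J (s n)) \<longlonglongrightarrow> J z"
    unfolding J_def using z(2) by (intro tendsto_intros)
  then have Jz: "J z = m" using Jlim LIMSEQ_unique by blast
  have "\<phi> u = u \<bullet> z" if u: "u \<in> S" for u
  proof (rule ccontr)
    assume neq: "\<phi> u \<noteq> u \<bullet> z"
    \<comment> \<open>Moving from \<open>z\<close> to \<open>z + t *\<^sub>R u\<close> changes
      \<open>J\<close> by \<open>t\<^sup>2 * (u \<bullet> u) - 2 * t * d\<close>. At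
      \<open>t = d / q\<close> this is at most \<open>- d * d / q\<close>, so minimality forces
      \<open>d = 0\<close>. The 1 in \<open>q\<close> covers \<open>u = 0\<close>.\<close>
    define d where "d = \<phi> u - u \<bullet> z"
    define q where "q = u \<bullet> u + 1"
    define t where "t = d / q"
    have q: "q > 0" unfolding q_def by (simp add: add_nonneg_pos)
    have tu: "t *\<^sub>R u \<in> S" using S(1) u by (rule subspace_scale)
    then have "J z \<le> J (z + t *\<^sub>R u)" unfolding Jz by (intro mle subspace_add[OF S(1) z(1)])
    also have "J (z + t *\<^sub>R u) = J z + t\<^sup>2 * (u \<bullet> u) - 2 * t * d"
      unfolding J_def add[OF z(1) tu] scale[OF u] d_def
      by (simp add: inner_add_left inner_add_right inner_commute power2_eq_square algebra_simps)
    finally have "2 * t * d \<le> t\<^sup>2 * (u \<bullet> u)" by simp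
    also have "\<dots> \<le> t\<^sup>2 * q" unfolding q_def by (simp add: mult_left_mono)
    also have "\<dots> = t * d" using q unfolding t_def by (simp add: power2_eq_square)
    finally have "d * d / q \<le> 0" unfolding t_def by simp
    then have "d * d \<le> 0" using q by (simp add: divide_le_0_iff)
    then have "d = 0" by (metis mult_eq_0_iff not_square_less_zero order_antisym_conv linorder_not_less)
    with neq show False unfolding d_def by simp
  qed
  with z(1) show thesis using that by blast
qed

text \<open>The projection of \<open>u\<close> is the Riesz vector of
  \<open>v \<mapsto> v \<bullet> u\<close> restricted to \<open>S\<close>.\<close>

lemma orthogonal_projection_on:
  fixes S :: "'a::real_inner set"
  assumes "subspace S" "Topological_Spaces.complete S"
  obtains p where "p \<in> S" "\<And>v. v \<in> S \<Longrightarrow> v \<bullet> (u - p) = 0"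
proof -
  have "bounded_linear_on S (\<lambda>v. v \<bullet> u)"
  proof (rule bounded_linear_onI)
    show "norm (v \<bullet> u) \<le> norm u * norm v" for v
      using Cauchy_Schwarz_ineq2[of v u] by (simp add: mult.commute)
  qed (simp_all add: inner_add_left)
  then obtain p where "p \<in> S" "\<And>v. v \<in> S \<Longrightarrow> v \<bullet> u = v \<bullet> p"
    using riesz_on[OF assms] by blast
  then show thesis using that by (simp add: inner_diff_right)
qed

text \<open>Riesz gives a candidate for the definite description; two candidates differ by a vector
  of \<open>S\<close> that is orthogonal to itself.\<close>

lemma adjoint_on:
  fixes f :: "'a::real_inner \<Rightarrow> 'c::real_inner"
  assumes S: "subspace S" "Topological_Spaces.complete S" and f: "bounded_linear_on S f"
  shows adjoint_on_in: "adjoint_on S f w \<in> S"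
    and adjoint_on_inner: "\<And>u. u \<in> S \<Longrightarrow> f u \<bullet> w = u \<bullet> adjoint_on S f w"
proof -
  obtain K where K: "K \<ge> 0" "\<And>u. u \<in> S \<Longrightarrow> norm (f u) \<le> K * norm u"
    using bounded_linear_on_bound[OF f] by blast
  have "bounded_linear_on S (\<lambda>u. f u \<bullet> w)"
  proof (rule bounded_linear_onI)
    show "norm (f u \<bullet> w) \<le> (K * norm w) * norm u" if "u \<in> S" for u
    proof -
      have "norm (f u \<bullet> w) \<le> norm (f u) * norm w" using Cauchy_Schwarz_ineq2 by simp
      also have "\<dots> \<le> (K * norm u) * norm w" using K(2)[OF that] by (rule mult_right_mono) simp
      finally show ?thesis by (simp add: mult_ac)
    qed
  qed (use f in \<open>auto simp: bounded_linear_on_def inner_add_left\<close>)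
  then obtain z where z: "z \<in> S" "\<And>u. u \<in> S \<Longrightarrow> f u \<bullet> w = u \<bullet> z"
    using riesz_on[OF S] by blast
  have "\<exists>!z. z \<in> S \<and> (\<forall>u\<in>S. f u \<bullet> w = u \<bullet> z)"
  proof (rule ex1I[of _ z])
    fix z' assume z': "z' \<in> S \<and> (\<forall>u\<in>S. f u \<bullet> w = u \<bullet> z')"
    then have "(z' - z) \<bullet> z' = (z' - z) \<bullet> z"
      using z subspace_diff[OF S(1), of z' z] by metis
    then have "(z' - z) \<bullet> (z' - z) = 0" by (simp add: inner_diff_right)
    then show "z' = z" by simp
  qed (use z in auto)
  from theI'[OF this] show "adjoint_on S f w \<in> S" "\<And>u. u \<in> S \<Longrightarrow> f u \<bullet> w = u \<bullet> adjoint_on S f w"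
    unfolding adjoint_on_def by auto
qed

section \<open>Supermartingales on index histories\<close>

text \<open>Histories list the most recent index first, so that adapted processes are functions
  defined by recursion on lists.\<close>

primrec history :: "(nat \<Rightarrow> 'b) \<Rightarrow> nat \<Rightarrow> 'b list" where
  "history s 0 = []"
| "history s (Suc n) = s n # history s n"

lemma length_history [simp]: "length (history s n) = n"
  by (induction n) auto

lemma history_eq_iff: "history s n = history t n \<longleftrightarrow> (\<forall>k<n. s k = t k)"
  by (induction n) (auto simp: less_Suc_eq)

text \<open>Turns the event that the history is a given list into conditions on single
  indices.\<close>

lemma ex_history: "\<exists>s. h = history s (length h)"
proof (induction h)
  case (Cons i h)
  then obtain s where s: "h = history s (length h)" by blast
  then have "h = history (s(length h := i)) (length h)"
    by (metis (mono_tags, lifting) fun_upd_other history_eq_iff less_irrefl_nat)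
  then have "i # h = history (s(length h := i)) (length (i # h))" by simp
  then show ?case by blast
qed simp

text \<open>For independent uniform indices, conditioning on the past is averaging over the next
  index, so the notion can be stated on lists without a probability space.\<close>

definition supermartingale :: "('b::finite list \<Rightarrow> real) \<Rightarrow> bool" where
  "supermartingale V \<longleftrightarrow>
     (\<forall>h. 0 \<le> V h) \<and> (\<forall>h. (\<Sum>i\<in>UNIV. V (i # h)) \<le> real CARD('b) * V h)"

text \<open>The state \<open>(True, q)\<close> means holding \<open>q\<close> shares, \<open>(False, w)\<close> means holding cash \<open>w\<close>.\<close>

definition trade :: "real \<Rightarrow> real \<Rightarrow> real \<Rightarrow> bool \<times> real \<Rightarrow> bool \<times> real" where
  "trade a b v s =
     (if fst s then if b \<le> v then (False, snd s * b) else s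
      else if v \<le> a then (True, snd s / a) else s)"

definition wealth :: "real \<Rightarrow> bool \<times> real \<Rightarrow> real" where
  "wealth v s = (if fst s then snd s * v else snd s)"

text \<open>Purchases are booked at exactly \<open>a\<close> and sales at exactly \<open>b\<close>,
  even when the price is better, so each round trip multiplies the cash by exactly
  \<open>b / a\<close>. Both levels recur, so a further round trip always follows.\<close>

lemma trade_reaches_power:
  assumes st: "s 0 = (False, 1)" "\<And>n. s (Suc n) = trade a b (v (Suc n)) (s n)"
    and low: "frequently (\<lambda>n. v n \<le> a) sequentially"
    and high: "frequently (\<lambda>n. b \<le> v n) sequentially"
  shows "\<exists>n. s n = (False, (b / a) ^ j)"
proof (induction j)
  case 0
  then show ?case using st(1) by auto
next
  have buy: "\<exists>n. s n = (True, w / a)" if "v (Suc (m + k)) \<le> a" "s m = (False, w)" for m k w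
    using that
  proof (induction k arbitrary: m)
    case 0
    then have "s (Suc m) = (True, w / a)" by (simp add: st(2) trade_def)
    then show ?case by blast
  next
    case (Suc k)
    show ?case
    proof (cases "v (Suc m) \<le> a")
      case True
      then have "s (Suc m) = (True, w / a)" using Suc.prems by (simp add: st(2) trade_def)
      then show ?thesis by blast
    next
      case False
      then have "s (Suc m) = (False, w)" using Suc.prems by (simp add: st(2) trade_def)
      then show ?thesis using Suc.IH[of "Suc m"] Suc.prems(1) by simp
    qed
  qed
  have sell: "\<exists>n. s n = (False, w * b)" if "b \<le> v (Suc (m + k))" "s m = (True, w)" for m k w
    using that
  proof (induction k arbitrary: m)
    case 0
    then have "s (Suc m) = (False, w * b)" by (simp add: st(2) trade_def)
    then show ?case by blast
  next
    case (Suc k)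
    show ?case
    proof (cases "b \<le> v (Suc m)")
      case True
      then have "s (Suc m) = (False, w * b)" using Suc.prems by (simp add: st(2) trade_def)
      then show ?thesis by blast
    next
      case False
      then have "s (Suc m) = (True, w)" using Suc.prems by (simp add: st(2) trade_def)
      then show ?thesis using Suc.IH[of "Suc m"] Suc.prems(1) by simp
    qed
  qed
  case (Suc j)
  then obtain m where m: "s m = (False, (b / a) ^ j)" by blast
  \<comment> \<open>The state \<open>s m\<close> has already reacted to \<open>v m\<close>; the next
    price that counts is \<open>v (Suc m)\<close>.\<close>
  obtain k where "k \<ge> Suc m" "v k \<le> a" using low unfolding frequently_sequentially by blast
  then obtain n where n: "s n = (True, (b / a) ^ j / a)"
    using buy[of m "k - Suc m"] m by auto
  obtain l where "l \<ge> Suc n" "b \<le> v l" using high unfolding frequently_sequentially by blast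
  then show ?case using sell[of n "l - Suc n"] n by (auto simp: mult.commute)
qed

text \<open>A bounded sequence has a cluster point \<open>l\<close>; without convergence it is
  infinitely often at distance at least \<open>e\<close> from \<open>l\<close> on one fixed side.
  Two rationals between \<open>l\<close> and that side are the levels.\<close>

lemma frequently_crossing:
  fixes v :: "nat \<Rightarrow> real"
  assumes "\<And>n. 0 \<le> v n" "\<And>n. v n \<le> C" "\<not> convergent v"
  obtains a b where "a \<in> \<rat>" "b \<in> \<rat>" "0 < a" "a < b"
    "frequently (\<lambda>n. v n \<le> a) sequentially" "frequently (\<lambda>n. b \<le> v n) sequentially"
proof -
  have "bounded (range v)"
    using assms(1,2) by (intro boundedI[of _ C]) auto
  then obtain l r where r: "strict_mono r" "(v \<circ> r) \<longlonglongrightarrow> l"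
    using bounded_imp_convergent_subsequence by blast
  have l0: "0 \<le> l" using r(2) assms(1) by (intro LIMSEQ_le_const) auto
  have sub: "frequently P sequentially" if "eventually (\<lambda>n. P (r n)) sequentially" for P
    using that r(1) unfolding frequently_sequentially eventually_sequentially
    by (meson dual_order.trans linorder_le_cases strict_mono_imp_increasing)
  have near: "frequently (\<lambda>n. v n \<le> c) sequentially" if "l < c" for c
    using order_tendstoD(2)[OF r(2) that] by (intro sub) (auto elim: eventually_mono)
  have near': "frequently (\<lambda>n. c \<le> v n) sequentially" if "c < l" for c
    using order_tendstoD(1)[OF r(2) that] by (intro sub) (auto elim: eventually_mono)
  have "\<not> v \<longlonglongrightarrow> l" using assms(3) convergentI by blast
  then obtain e where e: "e > 0" "\<not> eventually (\<lambda>n. dist (v n) l < e) sequentially"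
    unfolding tendsto_iff by blast
  have "frequently (\<lambda>n. l + e \<le> v n \<or> v n \<le> l - e) sequentially"
    using e(2) unfolding not_eventually by (rule frequently_elim1) (auto simp: dist_real_def)
  then consider "frequently (\<lambda>n. l + e \<le> v n) sequentially" | "frequently (\<lambda>n. v n \<le> l - e) sequentially"
    unfolding frequently_disj_iff by blast
  then show thesis
  proof cases
    case 1
    obtain b where b: "b \<in> \<rat>" "l < b" "b < l + e" using Rats_dense_in_real[of l "l + e"] e(1) by auto
    obtain a where a: "a \<in> \<rat>" "l < a" "a < b" using Rats_dense_in_real[OF b(2)] by auto
    show thesis
    proof (rule that[OF a(1) b(1) _ a(3) near[OF a(2)]])
      show "frequently (\<lambda>n. b \<le> v n) sequentially"
        using 1 by (rule frequently_elim1) (use b in auto)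
    qed (use l0 a in auto)
  next
    case 2
    then obtain n where "v n \<le> l - e" unfolding frequently_sequentially by blast
    \<comment> \<open>A value below \<open>l - e\<close> makes \<open>l - e\<close> nonnegative, so
      \<open>a\<close> is positive, as the division in \<open>trade\<close> requires.\<close>
    then have le: "0 \<le> l - e" using assms(1)[of n] by simp
    obtain b where b: "b \<in> \<rat>" "l - e < b" "b < l" using Rats_dense_in_real[of "l - e" l] e(1) by auto
    obtain a where a: "a \<in> \<rat>" "l - e < a" "a < b" using Rats_dense_in_real[OF b(2)] by auto
    show thesis
    proof (rule that[OF a(1) b(1) _ a(3) _ near'[OF b(3)]])
      show "frequently (\<lambda>n. v n \<le> a) sequentially"
        using 2 by (rule frequently_elim1) (use a in auto)
    qed (use le a in auto)
  qed
qed

section \<open>Independent uniform indices and almost sure supermartingale convergence\<close>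

locale uniform_indices = prob_space M
  for M :: "'w measure" and idx :: "nat \<Rightarrow> 'w \<Rightarrow> 'b::finite" +
  assumes indep: "indep_vars (\<lambda>_. count_space UNIV) idx UNIV"
    and uniform: "\<And>k. distr M (count_space UNIV) (idx k) = uniform_count_measure UNIV"
begin

abbreviation hist :: "nat \<Rightarrow> 'w \<Rightarrow> 'b list" where
  "hist n \<omega> \<equiv> history (\<lambda>k. idx k \<omega>) n"

lemma measurable_idx [measurable]: "idx k \<in> M \<rightarrow>\<^sub>M count_space UNIV"
  using indep unfolding indep_vars_def by simp

lemma measurable_hist [measurable]: "hist n \<in> M \<rightarrow>\<^sub>M count_space UNIV"
proof (induction n)
  case (Suc n)
  note [measurable] = Suc
  have "(\<lambda>\<omega>. (\<lambda>(i, h). i # h) (idx n \<omega>, hist n \<omega>)) \<in> M \<rightarrow>\<^sub>M count_space UNIV"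
  proof (rule measurable_compose[of _ _ "count_space UNIV \<Otimes>\<^sub>M count_space UNIV"])
    show "(\<lambda>(i :: 'b, h). i # h) \<in> count_space UNIV \<Otimes>\<^sub>M count_space UNIV \<rightarrow>\<^sub>M count_space UNIV"
      by (subst pair_measure_countable) auto
  qed measurable
  then show ?case by simp
qed simp

lemma measurable_function_of_hist: "(\<lambda>\<omega>. f (hist n \<omega>)) \<in> borel_measurable M"
  by measurable

lemma prob_hist:
  assumes "length h = n"
  shows "prob {\<omega> \<in> space M. hist n \<omega> = h} = (1 / real CARD('b)) ^ n"
\<comment> \<open>For \<open>n = 0\<close> the intersection below would be the whole type instead of
  \<open>space M\<close>.\<close>
proof (cases "n = 0")
  case True
  then show ?thesis using assms prob_space by simp
next
  case False
  obtain s where s: "h = history s n" using ex_history[of h] assms by auto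
  have one: "prob (idx k -` {i} \<inter> space M) = 1 / real CARD('b)" for k i
  proof -
    have "prob (idx k -` {i} \<inter> space M) = measure (distr M (count_space UNIV) (idx k)) {i}"
      by (subst measure_distr) auto
    also have "\<dots> = 1 / real CARD('b)"
      unfolding uniform by (subst measure_uniform_count_measure) auto
    finally show ?thesis .
  qed
  have "{\<omega> \<in> space M. hist n \<omega> = h} = (\<Inter>k\<in>{..<n}. idx k -` {s k} \<inter> space M)"
    using False unfolding s history_eq_iff by auto
  also have "prob \<dots> = (\<Prod>k\<in>{..<n}. prob (idx k -` {s k} \<inter> space M))"
    using False by (intro indep_varsD[OF indep]) auto
  finally show ?thesis by (simp add: one)
qed

lemma finite_histories: "finite {h :: 'b list. length h = n}"
  using finite_lists_length_eq[of "UNIV :: 'b set" n] by simp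

text \<open>A function of the first \<open>n\<close> indices takes finitely many values, so its
  expectation is the plain average over all histories of length \<open>n\<close>.\<close>

lemma expectation_hist:
  fixes f :: "'b list \<Rightarrow> real"
  shows "integrable M (\<lambda>\<omega>. f (hist n \<omega>))"
    and "expectation (\<lambda>\<omega>. f (hist n \<omega>)) = (\<Sum>h | length h = n. f h) / real CARD('b) ^ n"
proof -
  have *: "f (hist n \<omega>) = (\<Sum>h | length h = n. f h * indicator {\<omega> \<in> space M. hist n \<omega> = h} \<omega>)"
    if "\<omega> \<in> space M" for \<omega>
    using that finite_histories by (simp add: indicator_def if_distrib cong: if_cong)
  have meas: "{\<omega> \<in> space M. hist n \<omega> = h} \<in> sets M" for h by measurable
  have int: "integrable M (\<lambda>\<omega>. f h * indicator {\<omega> \<in> space M. hist n \<omega> = h} \<omega>)" for h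
    using meas by (intro integrable_mult_right integrable_real_indicator) (auto simp: emeasure_eq_measure)
  show "integrable M (\<lambda>\<omega>. f (hist n \<omega>))"
    by (subst Bochner_Integration.integrable_cong[OF refl *]) (use int in auto)
  have "expectation (\<lambda>\<omega>. f (hist n \<omega>)) =
      (\<Sum>h | length h = n. expectation (\<lambda>\<omega>. f h * indicator {\<omega> \<in> space M. hist n \<omega> = h} \<omega>))"
    by (subst Bochner_Integration.integral_cong[OF refl *]) (use int in \<open>auto intro: Bochner_Integration.integral_sum\<close>)
  also have "\<dots> = (\<Sum>h | length h = n. f h / real CARD('b) ^ n)"
    using meas by (intro sum.cong) (auto simp: prob_hist power_one_over)
  finally show "expectation (\<lambda>\<omega>. f (hist n \<omega>)) = (\<Sum>h | length h = n. f h) / real CARD('b) ^ n"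
    by (simp add: sum_divide_distrib)
qed

lemma expectation_supermartingale_le:
  assumes "supermartingale V"
  shows "expectation (\<lambda>\<omega>. V (hist n \<omega>)) \<le> V []"
proof (induction n)
  case (Suc n)
  \<comment> \<open>Splitting off the head, which is the latest index, exposes the inner sum that
    the supermartingale property bounds.\<close>
  have "(\<Sum>h | length h = Suc n. V h) = (\<Sum>(i, h)\<in>UNIV \<times> {h. length h = n}. V (i # h))"
    by (rule sum.reindex_bij_witness[of _ "\<lambda>(i, h). i # h" "\<lambda>h. (hd h, tl h)"])
      (auto simp: length_Suc_conv)
  also have "\<dots> = (\<Sum>h | length h = n. \<Sum>i\<in>UNIV. V (i # h))"
    by (simp add: sum.cartesian_product[symmetric] sum.swap[of _ UNIV])
  also have "\<dots> \<le> (\<Sum>h | length h = n. real CARD('b) * V h)"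
    using assms by (intro sum_mono) (simp add: supermartingale_def)
  finally have "(\<Sum>h | length h = Suc n. V h) \<le> real CARD('b) * (\<Sum>h | length h = n. V h)"
    by (simp add: sum_distrib_left)
  then have "(\<Sum>h | length h = Suc n. V h) / real CARD('b) ^ Suc n \<le> (\<Sum>h | length h = n. V h) / real CARD('b) ^ n"
    by (simp add: field_simps)
  with Suc show ?case unfolding expectation_hist(2) by (rule order_trans[rotated])
qed (simp add: prob_space)

lemma maximal_inequality:
  assumes V: "supermartingale V" and "c > 0"
  shows "prob {\<omega> \<in> space M. \<exists>k\<le>n. c \<le> V (hist k \<omega>)} \<le> V [] / c"
proof -
  txt \<open>\<open>W\<close> is \<open>V\<close> stopped when it reaches level \<open>c\<close>.\<close>
  define W where "W = rec_list (V []) (\<lambda>i h w. if c \<le> w then w else V (i # h))"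
  have W: "W [] = V []" "W (i # h) = (if c \<le> W h then W h else V (i # h))" for i h
    unfolding W_def by simp_all
  have V0: "V h \<ge> 0" and VS: "(\<Sum>i\<in>UNIV. V (i # h)) \<le> real CARD('b) * V h" for h
    using V unfolding supermartingale_def by auto
  have W0: "W h \<ge> 0" for h by (induction h) (simp_all add: W V0)
  have WV: "W h = V h" if "\<not> c \<le> W h" for h
    using that by (cases h) (auto simp: W split: if_splits)
  have sW: "supermartingale W"
    unfolding supermartingale_def
  proof (intro conjI allI)
    fix h show "(\<Sum>i\<in>UNIV. W (i # h)) \<le> real CARD('b) * W h"
      using VS[of h] WV[of h] by (cases "c \<le> W h") (auto simp: W)
  qed (rule W0)
  \<comment> \<open>Stopping preserves the fact that \<open>c\<close> was reached, so a statement
    about all times up to \<open>n\<close> becomes one about time \<open>n\<close>, where Markov's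
    inequality applies.\<close>
  have hit: "c \<le> W (history s n) \<longleftrightarrow> (\<exists>k\<le>n. c \<le> V (history s k))" for s n
    by (induction n) (auto simp: W le_Suc_eq)
  have "prob {\<omega> \<in> space M. \<exists>k\<le>n. c \<le> V (hist k \<omega>)} = prob {\<omega> \<in> space M. c \<le> W (hist n \<omega>)}"
    by (simp add: hit)
  also have "\<dots> \<le> expectation (\<lambda>\<omega>. W (hist n \<omega>)) / c"
    using W0 \<open>c > 0\<close> by (intro integral_Markov_inequality_measure[where A = "{}"] expectation_hist) auto
  also have "\<dots> \<le> V [] / c"
    using expectation_supermartingale_le[OF sW] \<open>c > 0\<close> by (simp add: divide_right_mono W)
  finally show ?thesis .
qed

text \<open>Letting \<open>n\<close> grow in the maximal inequality bounds the probability of ever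
  reaching \<open>c\<close> by \<open>V [] / c\<close>; an unbounded path reaches every
  level.\<close>

lemma supermartingale_AE_bounded:
  assumes V: "supermartingale V"
  shows "AE \<omega> in M. \<exists>C. \<forall>k. V (hist k \<omega>) \<le> C"
proof -
  define U where "U c = {\<omega> \<in> space M. \<exists>k. c \<le> V (hist k \<omega>)}" for c :: real
  have U [measurable]: "U c \<in> sets M" for c
    unfolding U_def by measurable
  have V0: "V h \<ge> 0" for h
    using V unfolding supermartingale_def by auto
  have le: "prob (U c) \<le> V [] / c" if "c > 0" for c
  proof (rule LIMSEQ_le_const2)
    have "(\<lambda>n. prob {\<omega> \<in> space M. \<exists>k\<le>n. c \<le> V (hist k \<omega>)}) \<longlonglongrightarrow>
        prob (\<Union>n. {\<omega> \<in> space M. \<exists>k\<le>n. c \<le> V (hist k \<omega>)})"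
    proof (rule finite_Lim_measure_incseq)
      show "incseq (\<lambda>n. {\<omega> \<in> space M. \<exists>k\<le>n. c \<le> V (hist k \<omega>)})"
        unfolding incseq_def by (auto intro: order_trans)
    qed (auto simp: measurable_function_of_hist)
    also have "(\<Union>n. {\<omega> \<in> space M. \<exists>k\<le>n. c \<le> V (hist k \<omega>)}) = U c"
      unfolding U_def by blast
    finally show "(\<lambda>n. prob {\<omega> \<in> space M. \<exists>k\<le>n. c \<le> V (hist k \<omega>)}) \<longlonglongrightarrow> prob (U c)" .
  qed (use maximal_inequality[OF V that] in auto)
  define Z where "Z = (\<Inter>m. U (real (Suc m)))"
  have [measurable]: "Z \<in> sets M" unfolding Z_def by measurable
  have "prob Z \<le> V [] * inverse (real (Suc m))" for m
  proof -
    have "prob Z \<le> prob (U (real (Suc m)))"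
      unfolding Z_def by (intro finite_measure_mono) auto
    also have "\<dots> \<le> V [] / real (Suc m)" by (rule le) simp
    finally show ?thesis by (simp add: divide_inverse)
  qed
  moreover have "(\<lambda>m. V [] * inverse (real (Suc m))) \<longlonglongrightarrow> 0"
    by (intro tendsto_mult_right_zero LIMSEQ_inverse_real_of_nat)
  ultimately have "prob Z \<le> 0" by (intro LIMSEQ_le_const) auto
  then have "prob Z = 0" by (simp add: measure_le_0_iff)
  then have "AE \<omega> in M. \<omega> \<notin> Z"
    by (intro AE_not_in) (auto simp: null_sets_def emeasure_eq_measure)
  then show ?thesis
  proof (rule AE_mp, intro AE_I2 impI)
    fix \<omega> assume "\<omega> \<in> space M" "\<omega> \<notin> Z"
    then obtain m where "\<And>k. \<not> real (Suc m) \<le> V (hist k \<omega>)"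
      unfolding Z_def U_def by blast
    then show "\<exists>C. \<forall>k. V (hist k \<omega>) \<le> C" by (metis linorder_le_cases)
  qed
qed


text \<open>A path that visits both levels infinitely often drives the wealth through all powers of
  \<open>b / a > 1\<close>, while the wealth is a nonnegative supermartingale and hence almost
  surely bounded.\<close>

lemma wealth_AE_bounded:
  fixes V :: "'b list \<Rightarrow> real"
  assumes V: "supermartingale V" and ab: "0 < a" "a < b"
  shows "AE \<omega> in M. \<not> (frequently (\<lambda>k. V (hist k \<omega>) \<le> a) sequentially \<and>
           frequently (\<lambda>k. b \<le> V (hist k \<omega>)) sequentially)"
proof -
  define s where "s = rec_list (False, 1) (\<lambda>i h. trade a b (V (i # h)))"
  have s: "s [] = (False, 1)" "s (i # h) = trade a b (V (i # h)) (s h)" for i h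
    unfolding s_def by simp_all
  have V0: "V h \<ge> 0" and VS: "(\<Sum>i\<in>UNIV. V (i # h)) \<le> real CARD('b) * V h" for h
    using V unfolding supermartingale_def by auto
  have s0: "snd (s h) \<ge> 0" for h
    using ab by (induction h) (auto simp: s trade_def)
  \<comment> \<open>A sale happens at a booked price \<open>b \<le> v\<close> and a purchase at a
    booked price \<open>a \<ge> v\<close>, so trading never gains at the current price.\<close>
  have step: "wealth v (trade a b v t) \<le> wealth v t" if "snd t \<ge> 0" for v t
    using that ab
    by (auto simp: wealth_def trade_def divide_le_eq mult_left_mono split: if_splits)
  have "supermartingale (\<lambda>h. wealth (V h) (s h))"
    unfolding supermartingale_def
  proof (intro conjI allI)
    fix h
    show "0 \<le> wealth (V h) (s h)" unfolding wealth_def using V0 s0 by simp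
    \<comment> \<open>First the price moves while the old position \<open>s h\<close> is held, then
      the trade takes place. With the position fixed, wealth is constant or a nonnegative multiple
      of \<open>V\<close>.\<close>
    have "(\<Sum>i\<in>UNIV. wealth (V (i # h)) (s (i # h))) \<le> (\<Sum>i\<in>UNIV. wealth (V (i # h)) (s h))"
      unfolding s using s0 by (intro sum_mono step)
    also have "\<dots> \<le> real CARD('b) * wealth (V h) (s h)"
      using mult_left_mono[OF VS[of h] s0[of h]]
      by (auto simp: wealth_def sum_distrib_left[symmetric] mult_ac)
    finally show "(\<Sum>i\<in>UNIV. wealth (V (i # h)) (s (i # h))) \<le> real CARD('b) * wealth (V h) (s h)" .
  qed
  from supermartingale_AE_bounded[OF this] show ?thesis
  proof (rule AE_mp, intro AE_I2 impI notI)
    fix \<omega>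
    assume "\<exists>C. \<forall>k. wealth (V (hist k \<omega>)) (s (hist k \<omega>)) \<le> C"
    then obtain C where C: "\<And>k. wealth (V (hist k \<omega>)) (s (hist k \<omega>)) \<le> C" by blast
    assume freq: "frequently (\<lambda>k. V (hist k \<omega>) \<le> a) sequentially \<and>
      frequently (\<lambda>k. b \<le> V (hist k \<omega>)) sequentially"
    have "(b / a) ^ j \<le> C" for j
    proof -
      obtain n where "s (hist n \<omega>) = (False, (b / a) ^ j)"
        using trade_reaches_power[of "\<lambda>n. s (hist n \<omega>)" a b "\<lambda>n. V (hist n \<omega>)" j] freq
        by (auto simp: s)
      then show ?thesis using C[of n] by (simp add: wealth_def)
    qed
    moreover obtain j where "C < (b / a) ^ j"
      using real_arch_pow[of "b / a" C] ab by auto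
    ultimately show False by (meson linorder_not_le)
  qed
qed

text \<open>Rational levels leave only countably many null events to exclude.\<close>

theorem supermartingale_AE_convergent:
  assumes V: "supermartingale V"
  shows "AE \<omega> in M. convergent (\<lambda>k. V (hist k \<omega>))"
proof -
  have "AE \<omega> in M. \<forall>(a, b)\<in>{(a, b). a \<in> \<rat> \<and> b \<in> \<rat> \<and> 0 < a \<and> a < b}.
      \<not> (frequently (\<lambda>k. V (hist k \<omega>) \<le> a) sequentially \<and>
           frequently (\<lambda>k. b \<le> V (hist k \<omega>)) sequentially)"
  proof (subst AE_ball_countable)
    show "countable {(a :: real, b :: real). a \<in> \<rat> \<and> b \<in> \<rat> \<and> 0 < a \<and> a < b}"
      by (rule countable_subset[of _ "\<rat> \<times> \<rat>"]) (auto intro: countable_rat)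
  qed (use wealth_AE_bounded[OF V] in auto)
  with supermartingale_AE_bounded[OF V] show ?thesis
  proof eventually_elim
    case (elim \<omega>)
    then obtain C where "\<And>k. V (hist k \<omega>) \<le> C" by blast
    moreover have "\<And>k. 0 \<le> V (hist k \<omega>)" using V unfolding supermartingale_def by blast
    ultimately show ?case
      using frequently_crossing[of "\<lambda>k. V (hist k \<omega>)" C] elim(2) by blast
  qed
qed

text \<open>Adding to \<open>V\<close> the accumulated decreases \<open>S\<close> gives a
  supermartingale again; its almost sure bound controls the partial sums of \<open>U\<close>. The
  increment is \<open>U h\<close> and not \<open>U (i # h)\<close>, so it is known before the next
  index is drawn.\<close>

lemma AE_summable_decrease:
  assumes nonneg: "\<And>h. 0 \<le> V h" "\<And>h. 0 \<le> U h"
    and decr: "\<And>h. (\<Sum>i\<in>UNIV. V (i # h)) \<le> real CARD('b) * (V h - U h)"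
  shows "AE \<omega> in M. summable (\<lambda>k. U (hist k \<omega>))"
proof -
  define S where "S = rec_list 0 (\<lambda>i h w. w + U h)"
  have S: "S [] = 0" "S (i # h) = S h + U h" for i :: 'b and h
    unfolding S_def by simp_all
  have S0: "S h \<ge> 0" for h by (induction h) (auto simp: S nonneg)
  have sum: "S (history s n) = (\<Sum>k<n. U (history s k))" for s n
    by (induction n) (simp_all add: S)
  have "supermartingale (\<lambda>h. V h + S h)"
    unfolding supermartingale_def
  proof (intro conjI allI)
    fix h
    show "(\<Sum>i\<in>UNIV. V (i # h) + S (i # h)) \<le> real CARD('b) * (V h + S h)"
      using decr[of h] by (simp add: S sum.distrib algebra_simps)
  qed (simp add: nonneg S0)
  from supermartingale_AE_bounded[OF this] show ?thesis
  proof eventually_elim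
    case (elim \<omega>)
    then obtain C where C: "\<And>k. V (hist k \<omega>) + S (hist k \<omega>) \<le> C" by blast
    show ?case
    proof (rule summableI_nonneg_bounded)
      show "(\<Sum>k<n. U (hist k \<omega>)) \<le> C" for n
        using C[of n] nonneg(1)[of "hist n \<omega>"] unfolding sum by simp
    qed (rule nonneg)
  qed
qed

end

section \<open>Weak measurability and weak limits\<close>

text \<open>Balls are determined by countably many inner products, as in Pettis' theorem.\<close>

lemma measurable_restrict_space_inner:
  fixes f :: "'w \<Rightarrow> 'a::real_inner"
  assumes B: "subspace B" and D: "countable D" "D \<subseteq> B" "B \<subseteq> closure D"
    and f: "f \<in> space M \<rightarrow> B" and meas: "\<And>u. u \<in> B \<Longrightarrow> (\<lambda>\<omega>. f \<omega> \<bullet> u) \<in> borel_measurable M"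
  shows "f \<in> M \<rightarrow>\<^sub>M restrict_space borel B"
proof (rule measurable_restrict_space2[OF f], rule borel_measurableI)
  fix U :: "'a set" assume U: "open U"
  \<comment> \<open>The inequality is closed in \<open>u\<close>, so it extends from
    \<open>D\<close> to \<open>v\<close> itself, where it reads
    \<open>v \<bullet> v \<le> r * norm v\<close>.\<close>
  have norm_le: "norm v \<le> r \<longleftrightarrow> (\<forall>u\<in>D. v \<bullet> u \<le> r * norm u)" if "v \<in> B" "r \<ge> 0" for v r
  proof
    assume "norm v \<le> r"
    then show "\<forall>u\<in>D. v \<bullet> u \<le> r * norm u"
      by (meson mult_right_mono norm_cauchy_schwarz norm_ge_zero order_trans)
  next
    assume *: "\<forall>u\<in>D. v \<bullet> u \<le> r * norm u"
    have "closure D \<subseteq> {u. v \<bullet> u \<le> r * norm u}"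
      by (rule closure_minimal) (use * in \<open>auto intro!: closed_Collect_le continuous_intros\<close>)
    then have "v \<bullet> v \<le> r * norm v" using D(3) that by auto
    then show "norm v \<le> r"
      using that(2) by (cases "v = 0") (auto simp: dot_square_norm power2_eq_square)
  qed
  have cball: "{\<omega> \<in> space M. f \<omega> \<in> cball c q} \<in> sets M" if "c \<in> D" "q \<ge> 0" for c q
  proof -
    have "{\<omega> \<in> space M. f \<omega> \<in> cball c q} = {\<omega> \<in> space M. \<forall>u\<in>D. f \<omega> \<bullet> u - c \<bullet> u \<le> q * norm u}"
      using f D(2) that subspace_diff[OF B]
      by (auto simp: dist_norm norm_minus_commute[of c] norm_le inner_diff_left Pi_iff subset_iff)
    also have "\<dots> \<in> sets M"
      by (rule sets.sets_Collect_countable_All'[OF _ D(1)]) (use meas D(2) in \<open>auto intro!: borel_measurable_le\<close>)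
    finally show ?thesis .
  qed
  \<comment> \<open>Countably many closed balls inside \<open>U\<close>, with centres in
    \<open>D\<close> and rational radii, cover the part of \<open>U\<close> in
    \<open>B\<close>.\<close>
  define I where "I = {(c, q). c \<in> D \<and> q \<in> \<rat> \<and> 0 \<le> q \<and> cball c q \<subseteq> U}"
  have "f -` U \<inter> space M = (\<Union>(c, q)\<in>I. {\<omega> \<in> space M. f \<omega> \<in> cball c q})"
  proof (intro equalityI subsetI)
    fix \<omega> assume \<omega>: "\<omega> \<in> f -` U \<inter> space M"
    then obtain e where e: "e > 0" "ball (f \<omega>) e \<subseteq> U" using U open_contains_ball by blast
    obtain q where q: "q \<in> \<rat>" "0 < q" "q < e / 2" using Rats_dense_in_real[of 0 "e / 2"] e(1) by auto
    have "f \<omega> \<in> closure D" using f \<omega> D(3) by auto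
    then obtain c where c: "c \<in> D" "dist c (f \<omega>) < q" using q(2) closure_approachable by blast
    have "cball c q \<subseteq> ball (f \<omega>) e"
    proof
      fix z assume "z \<in> cball c q"
      then show "z \<in> ball (f \<omega>) e"
        using c(2) q(3) dist_triangle[of "f \<omega>" z c] by (simp add: dist_commute)
    qed
    then have "(c, q) \<in> I" unfolding I_def using c q e by auto
    then show "\<omega> \<in> (\<Union>(c, q)\<in>I. {\<omega> \<in> space M. f \<omega> \<in> cball c q})" using \<omega> c by (auto intro!: bexI[of _ "(c, q)"])
  qed (auto simp: I_def)
  also have "\<dots> \<in> sets M"
  proof (rule sets.countable_UN')
    show "countable I"
      by (rule countable_subset[of _ "D \<times> \<rat>"]) (auto simp: I_def D(1) countable_rat)
  qed (use cball in \<open>auto simp: I_def\<close>)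
  finally show "f -` U \<inter> space M \<in> sets M" .
qed

text \<open>The vectors of \<open>B\<close> against which \<open>x\<close> converges form a
  subspace, closed because \<open>x\<close> is bounded. It contains \<open>G\<close>, so by totality
  its orthogonal complement in \<open>B\<close> is trivial. The limit functional is bounded by
  \<open>K\<close> and is represented by Riesz.\<close>

lemma weak_limit_exists:
  fixes x :: "nat \<Rightarrow> 'a::real_inner"
  assumes B: "subspace B" "Topological_Spaces.complete B"
    and x: "\<And>k. norm (x k) \<le> K"
    and G: "G \<subseteq> B" "\<And>g. g \<in> G \<Longrightarrow> convergent (\<lambda>k. x k \<bullet> g)"
    and total: "\<And>u. u \<in> B \<Longrightarrow> (\<And>g. g \<in> G \<Longrightarrow> g \<bullet> u = 0) \<Longrightarrow> u = 0"
  obtains z where "z \<in> B" "\<And>u. u \<in> B \<Longrightarrow> (\<lambda>k. x k \<bullet> u) \<longlonglongrightarrow> z \<bullet> u"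
proof -
  define C where "C = {u \<in> B. convergent (\<lambda>k. x k \<bullet> u)}"
  have K: "K \<ge> 0" using x norm_ge_zero order_trans by blast
  have bound: "\<bar>x k \<bullet> u\<bar> \<le> K * norm u" for k u
    by (meson Cauchy_Schwarz_ineq2 mult_right_mono norm_ge_zero order_trans x)
  have "subspace C"
    using B(1) unfolding C_def subspace_def
    by (auto simp: inner_add_right convergent_add convergent_const intro!: convergent_mult)
  moreover have "Topological_Spaces.complete C"
    unfolding complete_def
  proof (intro allI impI)
    fix s assume s: "(\<forall>n. s n \<in> C) \<and> Cauchy s"
    then obtain u where u: "u \<in> B" "s \<longlonglongrightarrow> u" using B(2) unfolding complete_def C_def by blast
    have "Cauchy (\<lambda>k. x k \<bullet> u)"
    proof (rule metric_CauchyI)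
      fix e :: real assume e: "e > 0"
      have "(\<lambda>n. K * norm (s n - u)) \<longlonglongrightarrow> 0"
        using u(2) by (intro tendsto_mult_right_zero tendsto_norm_zero LIM_zero)
      then have "\<forall>\<^sub>F n in sequentially. K * norm (s n - u) < e / 3"
        by (rule order_tendstoD) (use e in simp)
      then obtain n where n: "K * norm (s n - u) < e / 3"
        unfolding eventually_sequentially by blast
      have "Cauchy (\<lambda>k. x k \<bullet> s n)" using s convergent_Cauchy unfolding C_def by blast
      then obtain N where N: "\<And>i j. i \<ge> N \<Longrightarrow> j \<ge> N \<Longrightarrow> dist (x i \<bullet> s n) (x j \<bullet> s n) < e / 3"
        using e unfolding Cauchy_def by (meson divide_pos_pos zero_less_numeral)
      have "dist (x i \<bullet> u) (x j \<bullet> u) < e" if "i \<ge> N" "j \<ge> N" for i j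
        using N[OF that] n bound[of i "s n - u"] bound[of j "s n - u"]
        unfolding dist_real_def inner_diff_right by linarith
      then show "\<exists>N. \<forall>i\<ge>N. \<forall>j\<ge>N. dist (x i \<bullet> u) (x j \<bullet> u) < e" by blast
    qed
    then have "u \<in> C" using u(1) unfolding C_def by (simp add: Cauchy_convergent)
    then show "\<exists>l\<in>C. s \<longlonglongrightarrow> l" using u(2) by blast
  qed
  ultimately have C: "subspace C" "Topological_Spaces.complete C" .
  have "u \<in> C" if "u \<in> B" for u
  proof -
    obtain p where p: "p \<in> C" "\<And>v. v \<in> C \<Longrightarrow> v \<bullet> (u - p) = 0"
      using orthogonal_projection_on[OF C] by blast
    have "u - p \<in> B" using p(1) that subspace_diff[OF B(1)] unfolding C_def by blast
    then have "u - p = 0" using p(2) G by (intro total) (auto simp: C_def)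
    then show ?thesis using p(1) by simp
  qed
  then have conv: "(\<lambda>k. x k \<bullet> u) \<longlonglongrightarrow> lim (\<lambda>k. x k \<bullet> u)" if "u \<in> B" for u
    using that unfolding C_def by (simp add: convergent_LIMSEQ_iff)
  have "bounded_linear_on B (\<lambda>u. lim (\<lambda>k. x k \<bullet> u))"
  proof (rule bounded_linear_onI)
    fix u v assume "u \<in> B" "v \<in> B"
    then show "lim (\<lambda>k. x k \<bullet> (u + v)) = lim (\<lambda>k. x k \<bullet> u) + lim (\<lambda>k. x k \<bullet> v)"
      unfolding inner_add_right by (intro limI tendsto_add conv)
  next
    fix r u assume "u \<in> B"
    then show "lim (\<lambda>k. x k \<bullet> (r *\<^sub>R u)) = r *\<^sub>R lim (\<lambda>k. x k \<bullet> u)"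
      unfolding inner_scaleR_right real_scaleR_def by (intro limI tendsto_mult_left conv)
  next
    fix u assume "u \<in> B"
    then have "(\<lambda>k. \<bar>x k \<bullet> u\<bar>) \<longlonglongrightarrow> \<bar>lim (\<lambda>k. x k \<bullet> u)\<bar>" by (intro tendsto_rabs conv)
    then show "norm (lim (\<lambda>k. x k \<bullet> u)) \<le> K * norm u"
      unfolding real_norm_def by (rule LIMSEQ_le_const2) (use bound in blast)
  qed
  then obtain z where "z \<in> B" "\<And>u. u \<in> B \<Longrightarrow> lim (\<lambda>k. x k \<bullet> u) = u \<bullet> z"
    using riesz_on[OF B] by blast
  then show thesis using that conv by (simp add: inner_commute)
qed

section \<open>Block systems\<close>

lemma complete_block_space:
  fixes X :: "'b::finite \<Rightarrow> 'x::real_inner set"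
  assumes "\<And>i. Topological_Spaces.complete (X i)"
  shows "Topological_Spaces.complete (block_space X)"
  unfolding complete_def
proof (intro allI impI)
  fix s assume s: "(\<forall>n. s n \<in> block_space X) \<and> Cauchy s"
  have "\<exists>l\<in>X i. (\<lambda>n. s n $ i) \<longlonglongrightarrow> l" for i
  proof -
    have "Cauchy (\<lambda>n. s n $ i)"
      using s dist_vec_nth_le[of "s _" i "s _"] unfolding Cauchy_def by (meson order_le_less_trans)
    moreover have "\<forall>n. s n $ i \<in> X i" using s unfolding block_space_def by blast
    ultimately show ?thesis using assms[of i] unfolding complete_def by (metis (no_types, lifting))
  qed
  then obtain l where l: "\<And>i. l i \<in> X i" "\<And>i. (\<lambda>n. s n $ i) \<longlonglongrightarrow> l i" by metis
  have "s \<longlonglongrightarrow> (\<chi> i. l i)" by (rule vec_tendstoI) (simp add: l)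
  then show "\<exists>l\<in>block_space X. s \<longlonglongrightarrow> l" using l(1) by (intro bexI) (auto simp: block_space_def)
qed

text \<open>Histories start with the latest index, and \<open>foldr\<close> applies the head
  last.\<close>

lemma rbcd_eq_foldr: "rbcd X A y \<gamma> x0 s n = foldr (rbcd_step X A y \<gamma>) (history s n) x0"
  by (induction n) simp_all

section \<open>The block operator, its adjoint, and the mean decrease of one step\<close>

locale block_system =
  fixes X :: "'b::finite \<Rightarrow> 'x::real_inner set" and A :: "'b \<Rightarrow> 'x \<Rightarrow> 'y::real_inner"
  assumes sub: "\<And>i. subspace (X i)" and compl: "\<And>i. Topological_Spaces.complete (X i)"
    and lin: "\<And>i. bounded_linear_on (X i) (A i)"
begin

abbreviation "B \<equiv> block_space X"
abbreviation "F \<equiv> block_op A"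
abbreviation "L \<equiv> onorm_on B F"

text \<open>By \<open>inner_F\<close> this is the adjoint of \<open>block_op A\<close> on the block
  space; its \<open>i\<close>-th component at the residual is the direction of an RBCD step.\<close>

definition adj :: "'y \<Rightarrow> 'x ^ 'b" where
  "adj w = (\<chi> i. adjoint_on (X i) (A i) w)"

lemma subspace_B: "subspace B"
  using sub unfolding block_space_def subspace_def by auto

lemma complete_B: "Topological_Spaces.complete B"
  by (rule complete_block_space[OF compl])

lemma adj_nth_in: "adj w $ i \<in> X i"
  unfolding adj_def by (simp add: adjoint_on_in[OF sub compl lin])

lemma adj_in: "adj w \<in> B"
  unfolding block_space_def using adj_nth_in by simp

lemma inner_A: "x \<in> B \<Longrightarrow> A i (x $ i) \<bullet> w = x $ i \<bullet> adj w $ i"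
  unfolding block_space_def adj_def by (simp add: adjoint_on_inner[OF sub compl lin])

lemma inner_F: "x \<in> B \<Longrightarrow> F x \<bullet> w = x \<bullet> adj w"
  unfolding block_op_def inner_sum_left inner_vec_def by (simp add: inner_A)

lemma F_add: "u \<in> B \<Longrightarrow> v \<in> B \<Longrightarrow> F (u + v) = F u + F v"
  using lin unfolding block_op_def block_space_def bounded_linear_on_def
  by (simp add: sum.distrib)

lemma F_scale: "u \<in> B \<Longrightarrow> F (r *\<^sub>R u) = r *\<^sub>R F u"
  using lin unfolding block_op_def block_space_def bounded_linear_on_def
  by (simp add: scaleR_sum_right)

lemma F_diff: "u \<in> B \<Longrightarrow> v \<in> B \<Longrightarrow> F (u - v) = F u - F v"
  using F_add[of "u - v" v] subspace_diff[OF subspace_B] by simp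

lemma bounded_linear_on_F: "bounded_linear_on B F"
proof -
  have "\<exists>K\<ge>0. \<forall>u\<in>X i. norm (A i u) \<le> K * norm u" for i
    by (rule bounded_linear_on_bound[OF lin[of i]]) blast
  then obtain K where K: "\<And>i. K i \<ge> 0" "\<And>i u. u \<in> X i \<Longrightarrow> norm (A i u) \<le> K i * norm u"
    by metis
  show ?thesis
  proof (rule bounded_linear_onI)
    fix u assume u: "u \<in> B"
    have "norm (F u) \<le> (\<Sum>i\<in>UNIV. norm (A i (u $ i)))" unfolding block_op_def by (rule norm_sum)
    also have "\<dots> \<le> (\<Sum>i\<in>UNIV. K i * norm u)"
    proof (rule sum_mono)
      fix i
      have "norm (A i (u $ i)) \<le> K i * norm (u $ i)" using K(2) u unfolding block_space_def by simp
      also have "\<dots> \<le> K i * norm u" by (rule mult_left_mono[OF Finite_Cartesian_Product.norm_nth_le K(1)])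
      finally show "norm (A i (u $ i)) \<le> K i * norm u" .
    qed
    finally show "norm (F u) \<le> (\<Sum>i\<in>UNIV. K i) * norm u" by (simp add: sum_distrib_right)
  qed (simp_all add: F_add F_scale)
qed

text \<open>Apply Cauchy-Schwarz to \<open>F (adj w) \<bullet> w\<close>, which is the square of
  \<open>norm (adj w)\<close>, and cancel one factor.\<close>

lemma norm_adj_le: "norm (adj w) \<le> L * norm w"
proof -
  have "norm (adj w) * norm (adj w) = F (adj w) \<bullet> w"
    using inner_F[OF adj_in] by (simp add: power2_norm_eq_inner[symmetric] power2_eq_square)
  also have "\<dots> \<le> norm (F (adj w)) * norm w" by (rule norm_cauchy_schwarz)
  also have "\<dots> \<le> L * norm (adj w) * norm w"
    by (intro mult_right_mono norm_le_onorm_on[OF bounded_linear_on_F adj_in]) simp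
  finally have "norm (adj w) * norm (adj w) \<le> norm (adj w) * (L * norm w)" by (simp add: mult_ac)
  \<comment> \<open>The factor cannot be cancelled when it is 0; then \<open>L \<ge> 0\<close> is
    needed. On the zero space \<open>L\<close> is the single quotient 0/0, which is 0.\<close>
  moreover have "0 \<le> L * norm w" if "norm (adj w) = 0"
  proof (cases "B = {0}")
    case True
    have "F 0 = 0" using F_scale[of 0 0] subspace_0[OF subspace_B] by simp
    then show ?thesis unfolding onorm_on_def True by simp
  next
    case False
    then obtain u where "u \<in> B" "u \<noteq> 0" using subspace_0[OF subspace_B] by blast
    then have "0 \<le> L * norm u" using norm_le_onorm_on[OF bounded_linear_on_F] norm_ge_zero order_trans by blast
    then have "0 \<le> L" using \<open>u \<noteq> 0\<close> by (simp add: zero_le_mult_iff)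
    then show ?thesis by simp
  qed
  ultimately show ?thesis by (cases "norm (adj w) = 0") auto
qed

lemma rbcd_step_eq: "rbcd_step X A y \<gamma> i x = x - \<gamma> *\<^sub>R axis i (adj (F x - y) $ i)"
  unfolding rbcd_step_def adj_def by (auto simp: vec_eq_iff axis_def)

lemma rbcd_step_in: "x \<in> B \<Longrightarrow> rbcd_step X A y \<gamma> i x \<in> B"
  unfolding rbcd_step_def block_space_def
  using adj_nth_in[of _ i] by (auto simp: adj_def intro!: subspace_diff[OF sub] subspace_scale[OF sub])

lemma foldr_rbcd_step_in: "x \<in> B \<Longrightarrow> foldr (rbcd_step X A y \<gamma>) h x \<in> B"
  by (induction h) (simp_all add: rbcd_step_in)

text \<open>Step \<open>i\<close> sees only the \<open>i\<close>-th components, but summing over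
  \<open>i\<close> restores full inner products: the cross terms give
  \<open>(x - z) \<bullet> adj (F x - y)\<close>, the squared residual, and the quadratic terms give
  the square of \<open>norm (adj (F x - y))\<close>.\<close>

lemma sum_norm_rbcd_step_le:
  assumes x: "x \<in> B" and z: "z \<in> B" "F z = y"
  shows "(\<Sum>i\<in>UNIV. (norm (rbcd_step X A y \<gamma> i x - z))\<^sup>2) \<le>
    real CARD('b) * (norm (x - z))\<^sup>2 - \<gamma> * (2 - \<gamma> * L\<^sup>2) * (norm (F x - y))\<^sup>2"
proof -
  define a where "a = adj (F x - y)"
  have xz: "x - z \<in> B" using x z(1) by (rule subspace_diff[OF subspace_B])
  have expand: "(norm (d - \<gamma> *\<^sub>R e))\<^sup>2 = (norm d)\<^sup>2 - 2 * \<gamma> * (d \<bullet> e) + \<gamma>\<^sup>2 * (e \<bullet> e)"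
    for d e :: "'x ^ 'b"
    unfolding power2_norm_eq_inner
    by (simp add: inner_diff_left inner_diff_right inner_commute power2_eq_square)
  have "(norm (rbcd_step X A y \<gamma> i x - z))\<^sup>2 =
      (norm (x - z))\<^sup>2 - 2 * \<gamma> * ((x - z) $ i \<bullet> a $ i) + \<gamma>\<^sup>2 * (a $ i \<bullet> a $ i)" for i
  proof -
    have eq: "rbcd_step X A y \<gamma> i x - z = (x - z) - \<gamma> *\<^sub>R axis i (a $ i)"
      unfolding rbcd_step_eq a_def by simp
    show ?thesis
      unfolding eq expand by (simp add: inner_axis power2_norm_eq_inner)
  qed
  then have "(\<Sum>i\<in>UNIV. (norm (rbcd_step X A y \<gamma> i x - z))\<^sup>2) =
      real CARD('b) * (norm (x - z))\<^sup>2 - 2 * \<gamma> * ((x - z) \<bullet> a) + \<gamma>\<^sup>2 * (a \<bullet> a)"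
    by (simp add: sum.distrib sum_subtractf sum_distrib_left[symmetric] inner_vec_def)
  moreover have "(x - z) \<bullet> a = (norm (F x - y))\<^sup>2"
    using inner_F[OF xz, of "F x - y"] F_diff[OF x z(1)] z(2)
    by (simp add: a_def power2_norm_eq_inner)
  moreover have "\<gamma>\<^sup>2 * (a \<bullet> a) \<le> \<gamma>\<^sup>2 * (L\<^sup>2 * (norm (F x - y))\<^sup>2)"
  proof (rule mult_left_mono)
    have "(norm a)\<^sup>2 \<le> (L * norm (F x - y))\<^sup>2"
      unfolding a_def using norm_adj_le by (rule power_mono) simp
    then show "a \<bullet> a \<le> L\<^sup>2 * (norm (F x - y))\<^sup>2"
      by (simp add: power2_norm_eq_inner[symmetric] power_mult_distrib)
  qed simp
  ultimately show ?thesis by (simp add: algebra_simps power2_eq_square)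
qed

lemma kernel_subspace: "subspace {u \<in> B. F u = 0}"
proof -
  have "F 0 = 0" using F_scale[of 0 0] subspace_0[OF subspace_B] by simp
  then show ?thesis
    using subspace_B F_add F_scale unfolding subspace_def by auto
qed

text \<open>\<open>F u \<bullet> w = u \<bullet> adj w\<close> is continuous in \<open>u\<close>, so
  the kernel is closed in \<open>B\<close>.\<close>

lemma kernel_complete: "Topological_Spaces.complete {u \<in> B. F u = 0}"
  unfolding complete_def
proof (intro allI impI)
  fix s assume s: "(\<forall>n. s n \<in> {u \<in> B. F u = 0}) \<and> Cauchy s"
  then obtain u where u: "u \<in> B" "s \<longlonglongrightarrow> u"
    using complete_B unfolding complete_def by (metis (no_types, lifting) mem_Collect_eq)
  have "F u \<bullet> w = 0" for w
  proof -
    have "(\<lambda>n. s n \<bullet> adj w) \<longlonglongrightarrow> u \<bullet> adj w" by (intro tendsto_intros u(2))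
    moreover have "s n \<bullet> adj w = 0" for n using s inner_F[of "s n" w] by simp
    ultimately show ?thesis using inner_F[OF u(1), of w] by (simp add: LIMSEQ_const_iff)
  qed
  then have "F u = 0" by (metis inner_eq_zero_iff)
  then show "\<exists>l\<in>{u \<in> B. F u = 0}. s \<longlonglongrightarrow> l" using u by auto
qed

text \<open>The pathwise part of the theorem. Each \<open>n d\<close> is the projection of
  \<open>d\<close> onto the kernel, so \<open>z + n d\<close> is again a solution.\<close>

lemma weak_solution_limit:
  assumes z: "z \<in> B" "F z = y"
    and n: "\<And>d. d \<in> D \<Longrightarrow> n d \<in> B" "\<And>d. d \<in> D \<Longrightarrow> F (n d) = 0"
      "\<And>d v. d \<in> D \<Longrightarrow> v \<in> B \<Longrightarrow> F v = 0 \<Longrightarrow> v \<bullet> (d - n d) = 0"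
    and D: "B \<subseteq> closure D"
    and x: "\<And>k. x k \<in> B" "(\<lambda>k. F (x k)) \<longlonglongrightarrow> y"
    and conv: "convergent (\<lambda>k. (norm (x k - z))\<^sup>2)"
      "\<And>d. d \<in> D \<Longrightarrow> convergent (\<lambda>k. (norm (x k - (z + n d)))\<^sup>2)"
  obtains l where "l \<in> B" "F l = y" "\<And>u. u \<in> B \<Longrightarrow> (\<lambda>k. x k \<bullet> u) \<longlonglongrightarrow> l \<bullet> u"
proof -
  have adjlim: "(\<lambda>k. x k \<bullet> adj w) \<longlonglongrightarrow> y \<bullet> w" for w
    using x by (simp add: inner_F[symmetric] tendsto_inner)
  obtain K where "\<And>k. norm ((norm (x k - z))\<^sup>2) \<le> K"
    using convergent_imp_Bseq[OF conv(1)] unfolding Bseq_def by blast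
  then have "norm (x k - z) \<le> sqrt K" for k by (auto intro: real_le_rsqrt)
  then have bounded: "norm (x k) \<le> sqrt K + norm z" for k
    using norm_triangle_ineq[of "x k - z" z] by (smt (verit) diff_add_cancel)
  obtain l where l: "l \<in> B" "\<And>u. u \<in> B \<Longrightarrow> (\<lambda>k. x k \<bullet> u) \<longlonglongrightarrow> l \<bullet> u"
  proof (rule weak_limit_exists[OF subspace_B complete_B bounded])
    show "range adj \<union> n ` D \<subseteq> B" using adj_in n(1) by auto
    show "convergent (\<lambda>k. x k \<bullet> g)" if "g \<in> range adj \<union> n ` D" for g
      using that
    proof
      assume "g \<in> range adj"
      then show ?thesis using adjlim convergentI by blast
    next
      assume "g \<in> n ` D"
      then obtain d where d: "d \<in> D" "g = n d" by blast
      \<comment> \<open>Polarisation: the difference of the two squared distances is affine in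
        \<open>x k \<bullet> n d\<close>.\<close>
      have "(\<lambda>k. x k \<bullet> g) = (\<lambda>k. (1 / 2) * ((norm (x k - z))\<^sup>2 - (norm (x k - (z + n d)))\<^sup>2)
          + (z \<bullet> n d + n d \<bullet> n d / 2))"
        unfolding d(2) power2_norm_eq_inner
        by (simp add: inner_diff_left inner_diff_right inner_add_left inner_add_right inner_commute
          field_simps)
      then show ?thesis
        using conv(1) conv(2)[OF d(1)]
        by (simp only:) (intro convergent_add convergent_mult convergent_diff convergent_const)
    qed
    fix u assume u: "u \<in> B" and orth: "\<And>g. g \<in> range adj \<union> n ` D \<Longrightarrow> g \<bullet> u = 0"
    \<comment> \<open>Totality: orthogonality to \<open>adj (F u)\<close> puts \<open>u\<close> in
      the kernel. Then \<open>u\<close> is orthogonal to \<open>d - n d\<close> and to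
      \<open>n d\<close>, hence to the dense set \<open>D\<close>.\<close>
    have "F u \<bullet> F u = 0"
      using inner_F[OF u] orth[of "adj (F u)"] by (simp add: inner_commute)
    then have Fu: "F u = 0" by simp
    have "u \<bullet> d = 0" if "d \<in> D" for d
      using n(3)[OF that u Fu] orth[of "n d"] that by (simp add: inner_diff_right inner_commute)
    then have "closure D \<subseteq> {v. u \<bullet> v = 0}"
      by (intro closure_minimal) (auto intro!: closed_Collect_eq continuous_intros)
    then show "u = 0" using D u by auto
  qed blast
  have "F l \<bullet> w = y \<bullet> w" for w
    using LIMSEQ_unique[OF l(2)[OF adj_in] adjlim, of w] inner_F[OF l(1)] by simp
  then have "(F l - y) \<bullet> (F l - y) = 0" by (simp add: inner_diff_left)
  then have "F l = y" by simp
  with l show thesis using that by blast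
qed

end

section \<open>Almost sure weak convergence of RBCD\<close>

theorem theorem2p4:
  fixes X :: "'b::finite \<Rightarrow> 'x::real_inner set"
    and A :: "'b \<Rightarrow> 'x \<Rightarrow> 'y::{real_inner, complete_space}"
    and y :: 'y and x0 :: "'x ^ 'b" and \<gamma> :: real
    and M :: "'w measure" and idx :: "nat \<Rightarrow> 'w \<Rightarrow> 'b"
  assumes "\<And>i. subspace (X i)" and "\<And>i. Topological_Spaces.complete (X i)"
    and "\<And>i. bounded_linear_on (X i) (A i)"
    and "y \<in> block_op A ` block_space X"
    and "x0 \<in> block_space X"
    and "separable_space (top_of_set (block_space X))"
    and "\<gamma> > 0"
    and "onorm_on (block_space X) (block_op A) \<noteq> 0 \<Longrightarrow>
           \<gamma> < 2 / (onorm_on (block_space X) (block_op A))\<^sup>2"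
    and "prob_space M"
    and "prob_space.indep_vars M (\<lambda>_. count_space UNIV) idx UNIV"
    and "\<And>k. distr M (count_space UNIV) (idx k) = uniform_count_measure UNIV"
  shows "\<exists>E \<in> sets M. \<exists>xbar \<in> M \<rightarrow>\<^sub>M restrict_space borel (block_space X).
           measure M E = 1 \<and>
           (\<forall>\<omega>\<in>E. block_op A (xbar \<omega>) = y \<and>
              weakly_converges_on (block_space X)
                (\<lambda>k. rbcd X A y \<gamma> x0 (\<lambda>n. idx n \<omega>) k) (xbar \<omega>))"
proof -
  interpret block_system X A by unfold_locales (fact assms)+
  interpret uniform_indices M idx
    unfolding uniform_indices_def uniform_indices_axioms_def using assms(9-11) by blast
  obtain z where z: "z \<in> B" "F z = y" using assms(4) by blast
  obtain D where D: "countable D" "D \<subseteq> B" "B \<subseteq> closure D"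
  proof -
    obtain C where "countable C" "C \<subseteq> B" "top_of_set B closure_of C = B"
      using assms(6) unfolding separable_space_def by auto
    then have "B \<subseteq> closure C" by (simp add: closure_of_subtopology inf.absorb2) blast
    then show thesis using that[of C] \<open>countable C\<close> \<open>C \<subseteq> B\<close> by blast
  qed
  have "\<exists>p. p \<in> B \<and> F p = 0 \<and> (\<forall>v\<in>B. F v = 0 \<longrightarrow> v \<bullet> (d - p) = 0)" for d
    using orthogonal_projection_on[OF kernel_subspace kernel_complete, of d] by (metis (mono_tags, lifting) mem_Collect_eq)
  then obtain n where n: "\<And>d. n d \<in> B" "\<And>d. F (n d) = 0"
      "\<And>d v. v \<in> B \<Longrightarrow> F v = 0 \<Longrightarrow> v \<bullet> (d - n d) = 0"
    by metis
  define x where "x h = foldr (rbcd_step X A y \<gamma>) h x0" for h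
  have x_Cons: "x (i # h) = rbcd_step X A y \<gamma> i (x h)" for i h unfolding x_def by simp
  have xB: "x h \<in> B" for h unfolding x_def by (rule foldr_rbcd_step_in[OF assms(5)])
  define c where "c = \<gamma> * (2 - \<gamma> * L\<^sup>2)"
  have c: "c > 0"
  \<comment> \<open>The upper bound on \<gamma> is available only for \<open>L \<noteq> 0\<close>;
    otherwise \<open>c = 2 * \<gamma>\<close>.\<close>
  proof (cases "L = 0")
    case False
    then show ?thesis using assms(7) assms(8)[OF False] unfolding c_def by (simp add: less_divide_eq)
  qed (use assms(7) in \<open>simp add: c_def\<close>)
  have step: "(\<Sum>i\<in>UNIV. (norm (x (i # h) - w))\<^sup>2) \<le>
      real CARD('b) * (norm (x h - w))\<^sup>2 - c * (norm (F (x h) - y))\<^sup>2"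
    if "w \<in> B" "F w = y" for h w
    unfolding x_Cons c_def by (rule sum_norm_rbcd_step_le[OF xB that])
  have conv: "AE \<omega> in M. convergent (\<lambda>k. (norm (x (hist k \<omega>) - w))\<^sup>2)" if "w \<in> B" "F w = y" for w
  proof (rule supermartingale_AE_convergent)
    have "0 \<le> c * (norm (F (x h) - y))\<^sup>2" for h using c by simp
    then show "supermartingale (\<lambda>h. (norm (x h - w))\<^sup>2)"
      unfolding supermartingale_def using order_trans[OF step[OF that]] by simp
  qed
  have "AE \<omega> in M. summable (\<lambda>k. c / real CARD('b) * (norm (F (x (hist k \<omega>)) - y))\<^sup>2)"
  proof (rule AE_summable_decrease)
    show "(\<Sum>i\<in>UNIV. (norm (x (i # h) - z))\<^sup>2) \<le>
        real CARD('b) * ((norm (x h - z))\<^sup>2 - c / real CARD('b) * (norm (F (x h) - y))\<^sup>2)" for h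
      using step[OF z, of h] by (simp add: right_diff_distrib)
  qed (use c in auto)
  \<comment> \<open>The exceptional null set depends on the solution; countability of
    \<open>D\<close> gives one event for all \<open>z + n d\<close>.\<close>
  moreover have "AE \<omega> in M. \<forall>d\<in>D. convergent (\<lambda>k. (norm (x (hist k \<omega>) - (z + n d)))\<^sup>2)"
    using z n D(1) by (subst AE_ball_countable) (auto intro!: conv subspace_add[OF subspace_B] simp: F_add)
  moreover note conv[OF z]
  ultimately have "AE \<omega> in M. \<exists>l. l \<in> B \<and> F l = y \<and> (\<forall>u\<in>B. (\<lambda>k. x (hist k \<omega>) \<bullet> u) \<longlonglongrightarrow> l \<bullet> u)"
  proof eventually_elim
    case (elim \<omega>)
    have "(\<lambda>k. c / real CARD('b) * (norm (F (x (hist k \<omega>)) - y))\<^sup>2) \<longlonglongrightarrow> 0"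
      by (rule summable_LIMSEQ_zero[OF elim(1)])
    then have "(\<lambda>k. (norm (F (x (hist k \<omega>)) - y))\<^sup>2) \<longlonglongrightarrow> 0"
      using c tendsto_mult_left_iff[of "c / real CARD('b)" _ 0] by simp
    then have "(\<lambda>k. sqrt ((norm (F (x (hist k \<omega>)) - y))\<^sup>2)) \<longlonglongrightarrow> sqrt 0"
      by (rule tendsto_real_sqrt)
    then have "(\<lambda>k. norm (F (x (hist k \<omega>)) - y)) \<longlonglongrightarrow> 0" by simp
    then have "(\<lambda>k. F (x (hist k \<omega>))) \<longlonglongrightarrow> y"
      by (rule LIM_zero_cancel[OF tendsto_norm_zero_cancel])
    then obtain l where "l \<in> B" "F l = y" "\<And>u. u \<in> B \<Longrightarrow> (\<lambda>k. x (hist k \<omega>) \<bullet> u) \<longlonglongrightarrow> l \<bullet> u"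
      using weak_solution_limit[OF z n D(3), of "\<lambda>k. x (hist k \<omega>)"] xB elim by blast
    then show ?case by blast
  qed
  then obtain N where N: "N \<in> null_sets M"
    "\<And>\<omega>. \<omega> \<in> space M - N \<Longrightarrow> \<exists>l. l \<in> B \<and> F l = y \<and> (\<forall>u\<in>B. (\<lambda>k. x (hist k \<omega>) \<bullet> u) \<longlonglongrightarrow> l \<bullet> u)"
    by (auto elim!: AE_E3)
  \<comment> \<open>The complement of a null set serves as the event, since it is measurable by
    construction.\<close>
  define E where "E = space M - N"
  have E [measurable]: "E \<in> sets M" unfolding E_def using N(1) by auto
  have "prob E = 1"
    unfolding E_def using N(1) prob_compl[of N] by (simp add: measure_eq_0_null_sets null_setsD2)
  from N(2) obtain l where l: "\<And>\<omega>. \<omega> \<in> E \<Longrightarrow> l \<omega> \<in> B" "\<And>\<omega>. \<omega> \<in> E \<Longrightarrow> F (l \<omega>) = y"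
    "\<And>\<omega> u. \<omega> \<in> E \<Longrightarrow> u \<in> B \<Longrightarrow> (\<lambda>k. x (hist k \<omega>) \<bullet> u) \<longlonglongrightarrow> l \<omega> \<bullet> u"
    unfolding E_def by metis
  \<comment> \<open>The default \<open>x0\<close> keeps \<open>xbar\<close> in \<open>B\<close> off
    \<open>E\<close>; there the approximants of \<open>xbar \<omega> \<bullet> u\<close> below are
    constant, so they converge at every sample point.\<close>
  define xbar where "xbar \<omega> = (if \<omega> \<in> E then l \<omega> else x0)" for \<omega>
  have "xbar \<in> M \<rightarrow>\<^sub>M restrict_space borel B"
  proof (rule measurable_restrict_space_inner[OF subspace_B D])
    show "xbar \<in> space M \<rightarrow> B" unfolding xbar_def using l(1) assms(5) by auto
    fix u assume u: "u \<in> B"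
    have "(\<lambda>\<omega>. if \<omega> \<in> E then x (hist k \<omega>) \<bullet> u else x0 \<bullet> u) \<in> borel_measurable M" for k
      using measurable_function_of_hist[of "\<lambda>h. x h \<bullet> u" k] by measurable
    then show "(\<lambda>\<omega>. xbar \<omega> \<bullet> u) \<in> borel_measurable M"
      by (rule borel_measurable_LIMSEQ_real[rotated]) (use l(3)[OF _ u] in \<open>auto simp: xbar_def\<close>)
  qed
  moreover have "weakly_converges_on B (\<lambda>k. rbcd X A y \<gamma> x0 (\<lambda>n. idx n \<omega>) k) (xbar \<omega>)" if "\<omega> \<in> E" for \<omega>
    unfolding weakly_converges_on_def rbcd_eq_foldr x_def[symmetric]
  proof (intro conjI allI impI xB)
    show "xbar \<omega> \<in> B" using that l(1) by (simp add: xbar_def)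
    fix \<phi> :: "'x ^ 'b \<Rightarrow> real" assume "bounded_linear_on B \<phi>"
    then obtain u where u: "u \<in> B" "\<And>v. v \<in> B \<Longrightarrow> \<phi> v = v \<bullet> u"
      using riesz_on[OF subspace_B complete_B] by blast
    then show "(\<lambda>k. \<phi> (x (hist k \<omega>))) \<longlonglongrightarrow> \<phi> (xbar \<omega>)"
      using l(1,3) that xB by (simp add: xbar_def)
  qed
  ultimately show ?thesis
    using E \<open>prob E = 1\<close> l(2) by (intro bexI[of _ E] bexI[of _ xbar]) (auto simp: xbar_def)
qed

end
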